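(* Let $E$ be a graph, let $g\in E^1$ be an edge such that $s_E(g)$ is a regular vertex, and let $E_g$ be the subdivision of $E$ at $g$. Then the formulas $$f(v)=v\ \text{ for } v\in E^0,\qquad f(e)=\begin{cases}e& e\in E^1\setminus\{g\}\\ gg'& e=g\end{cases}$$ define an admissible path homomorphism $f\colon \mathrm{FP}(E)\to\mathrm{FP}(E_g)$.
   Context: A graph $E=(E^0,E^1,s_E,t_E)$ consists of arbitrary sets of vertices and edges with source and target maps. A vertex $v$ is regular if $s_E^{-1}(v)$ is finite and nonempty; $\mathrm{reg}(E)$ is the set of regular vertices, and $\mathrm{reg}_0(E)=\{v\in\mathrm{reg}(E)\mid s_E^{-1}(v)=\{e\}\text{ and }t_E(e)=v\}$. $\mathrm{FP}(E)$ is the set of finite paths (vertices, of length $0$, and sequences $e_1\ldots e_n$ of edges with $t_E(e_i)=s_E(e_{i+1})$); source and target extend to paths, vertices act as units for concatenation. Write $\alpha\preceq\beta$ if $\beta=\alpha\gamma$ for some path $\gamma$. Subdivision at $g$: $E_g^0=E^0\sqcup\{t_E(g)'\}$ and $E_g^1=E^1\sqcup\{g'\}$, where $t_E(g)'$ is a new vertex and $g'$ a new edge; $s_{E_g}(e)=s_E(e)$ for $e\in E^1$, $s_{E_g}(g')=t_E(g)'$; $t_{E_g}(e)=t_E(e)$ for $e\in E^1\setminus\{g\}$, $t_{E_g}(g)=t_E(g)'$, $t_{E_g}(g')=t_E(g)$. A path homomorphism from $E$ to $F$ is a map $f\colon \mathrm{FP}(E)\to\mathrm{FP}(F)$ with $f(E^0)\subseteq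 F^0$, commuting with source and target, and with $f(pq)=f(p)f(q)$ whenever $t_E(p)=s_E(q)$. It is monotonic if for edges $e,e'\in E^1$, $f(e)\preceq f(e')$ implies $e=e'$. For $v\in\mathrm{reg}(E)$ consider the condition $(\ast_v)$: (a) $f$ is injective on $s_E^{-1}(v)$; and (b) a path $p$ in $F$ lies in $f(s_E^{-1}(v))$ if and only if (i) $p=e_1\ldots e_n$ with $n\ge1$ and all $e_i\in F^1$, (ii) $pq\in f(s_E^{-1}(v))$ implies $q=t_F(p)$, and (iii) for all $i\in\{1,\ldots,n\}$ and $e\in s_F^{-1}(s_F(e_i))$ there is $r\in\mathrm{FP}(F)$ with $e_1\ldots e_{i-1}er\in f(s_E^{-1}(v))$. The path homomorphism $f$ is regular if $(\ast_v)$ holds for every $v\in\mathrm{reg}(E)\setminus\mathrm{reg}_0(E)$ and, for every $v\in\mathrm{reg}_0(E)$, either $(\ast_v)$ holds or $f(s_E^{-1}(v))=\{f(v)\}$. A path homomorphism is admissible if it is injective on vertices, monotonic and regular. *)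

theory Defs
  imports "Graph_Theory.Arc_Walk"
begin

text \<open>
  Graphs are \<open>wf_digraph\<close>s (arbitrary vertex and arc sets, loops and multiple arcs allowed);
  the source map is \<open>tail\<close> and the target map is \<open>head\<close>.
\<close>

definition regular_verts :: "('a, 'b) pre_digraph \<Rightarrow> 'a set" where
  "regular_verts E = {v \<in> verts E. finite (out_arcs E v) \<and> out_arcs E v \<noteq> {}}"

definition regular_verts0 :: "('a, 'b) pre_digraph \<Rightarrow> 'a set" where
  "regular_verts0 E = {v \<in> regular_verts E. \<exists>e. out_arcs E v = {e} \<and> head E e = v}"

text \<open>
  A finite path is encoded as its source vertex together with its list of arcs, so that the path of
  length 0 at \<open>v\<close> is \<open>(v, [])\<close> and \<open>e\<^sub>1\<dots>e\<^sub>n\<close> is \<open>(tail E e\<^sub>1, [e\<^sub>1, \<dots>, e\<^sub>n])\<close>.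
\<close>

type_synonym ('a, 'b) path = "'a \<times> 'b list"

definition FP :: "('a, 'b) pre_digraph \<Rightarrow> ('a, 'b) path set" where
  "FP E = {(u, p). \<exists>v. pre_digraph.awalk E u p v}"

definition vertex_path :: "'a \<Rightarrow> ('a, 'b) path" where
  "vertex_path v = (v, [])"

definition arc_path :: "('a, 'b) pre_digraph \<Rightarrow> 'b \<Rightarrow> ('a, 'b) path" where
  "arc_path E e = (tail E e, [e])"

definition path_source :: "('a, 'b) path \<Rightarrow> 'a" where
  "path_source p = fst p"

definition path_target :: "('a, 'b) pre_digraph \<Rightarrow> ('a, 'b) path \<Rightarrow> 'a" where
  "path_target E p = pre_digraph.awlast E (fst p) (snd p)"

text \<open>Concatenation is only meaningful if the target of the first path is the source of the second.\<close>

definition path_concat :: "('a, 'b) path \<Rightarrow> ('a, 'b) path \<Rightarrow> ('a, 'b) path" where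
  "path_concat p q = (fst p, snd p @ snd q)"

definition path_prefix :: "('a, 'b) pre_digraph \<Rightarrow> ('a, 'b) path \<Rightarrow> ('a, 'b) path \<Rightarrow> bool" where
  "path_prefix E p q \<longleftrightarrow>
     (\<exists>r \<in> FP E. path_source r = path_target E p \<and> q = path_concat p r)"

definition path_homomorphism ::
  "('a, 'b) pre_digraph \<Rightarrow> ('c, 'd) pre_digraph \<Rightarrow> (('a, 'b) path \<Rightarrow> ('c, 'd) path) \<Rightarrow> bool" where
  "path_homomorphism E F f \<longleftrightarrow>
     f ` FP E \<subseteq> FP F \<and>
     f ` vertex_path ` verts E \<subseteq> vertex_path ` verts F \<and>
     (\<forall>p \<in> FP E. f (vertex_path (path_source p)) = vertex_path (path_source (f p))) \<and>
     (\<forall>p \<in> FP E. f (vertex_path (path_target E p)) = vertex_path (path_target F (f p))) \<and>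
     (\<forall>p \<in> FP E. \<forall>q \<in> FP E. path_target E p = path_source q \<longrightarrow>
        f (path_concat p q) = path_concat (f p) (f q))"

definition path_monotonic ::
  "('a, 'b) pre_digraph \<Rightarrow> ('c, 'd) pre_digraph \<Rightarrow> (('a, 'b) path \<Rightarrow> ('c, 'd) path) \<Rightarrow> bool" where
  "path_monotonic E F f \<longleftrightarrow>
     (\<forall>e \<in> arcs E. \<forall>e' \<in> arcs E. path_prefix F (f (arc_path E e)) (f (arc_path E e')) \<longrightarrow> e = e')"

definition out_image ::
  "('a, 'b) pre_digraph \<Rightarrow> (('a, 'b) path \<Rightarrow> ('c, 'd) path) \<Rightarrow> 'a \<Rightarrow> ('c, 'd) path set" where
  "out_image E f v = f ` arc_path E ` out_arcs E v"

text \<open>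
  The condition \<open>(\<ast>\<^sub>v)\<close>. Positions in \<open>es\<close> are counted from 0, so that \<open>take i es\<close> is the
  part of the path strictly before the arc \<open>es ! i\<close>.
\<close>

definition regular_at ::
  "('a, 'b) pre_digraph \<Rightarrow> ('c, 'd) pre_digraph \<Rightarrow> (('a, 'b) path \<Rightarrow> ('c, 'd) path) \<Rightarrow> 'a \<Rightarrow> bool" where
  "regular_at E F f v \<longleftrightarrow>
     inj_on f (arc_path E ` out_arcs E v) \<and>
     (\<forall>(u, es) \<in> FP F.
        (u, es) \<in> out_image E f v \<longleftrightarrow>
          es \<noteq> [] \<and>
          (\<forall>q \<in> FP F. path_source q = path_target F (u, es) \<and> path_concat (u, es) q \<in> out_image E f v
             \<longrightarrow> q = vertex_path (path_target F (u, es))) \<and>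
          (\<forall>i < length es. \<forall>e \<in> out_arcs F (tail F (es ! i)).
             \<exists>r \<in> FP F. path_source r = head F e \<and>
               path_concat (u, take i es @ [e]) r \<in> out_image E f v))"

definition path_regular ::
  "('a, 'b) pre_digraph \<Rightarrow> ('c, 'd) pre_digraph \<Rightarrow> (('a, 'b) path \<Rightarrow> ('c, 'd) path) \<Rightarrow> bool" where
  "path_regular E F f \<longleftrightarrow>
     (\<forall>v \<in> regular_verts E - regular_verts0 E. regular_at E F f v) \<and>
     (\<forall>v \<in> regular_verts0 E. regular_at E F f v \<or> out_image E f v = {f (vertex_path v)})"

definition admissible_path_homomorphism ::
  "('a, 'b) pre_digraph \<Rightarrow> ('c, 'd) pre_digraph \<Rightarrow> (('a, 'b) path \<Rightarrow> ('c, 'd) path) \<Rightarrow> bool" where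
  "admissible_path_homomorphism E F f \<longleftrightarrow>
     path_homomorphism E F f \<and>
     inj_on f (vertex_path ` verts E) \<and>
     path_monotonic E F f \<and>
     path_regular E F f"

text \<open>
  In the subdivision at \<open>g\<close>, the old vertices and arcs are tagged by \<open>Some\<close>; \<open>None\<close> is
  the new vertex \<open>t(g)'\<close>, respectively the new arc \<open>g'\<close>.
\<close>

definition subdivision ::
  "('a, 'b) pre_digraph \<Rightarrow> 'b \<Rightarrow> ('a option, 'b option) pre_digraph" where
  "subdivision E g =
     \<lparr> verts = insert None (Some ` verts E),
       arcs = insert None (Some ` arcs E),
       tail = (\<lambda>x. case x of None \<Rightarrow> None | Some e \<Rightarrow> Some (tail E e)),
       head = (\<lambda>x. case x of None \<Rightarrow> Some (head E g)
                           | Some e \<Rightarrow> if e = g then None else Some (head E e)) \<rparr>"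

lemma wf_digraph_subdivision:
  assumes "wf_digraph E" "g \<in> arcs E"
  shows "wf_digraph (subdivision E g)"
  using assms unfolding wf_digraph_def subdivision_def by (auto split: if_splits)

definition subdivision_formulas ::
  "('a, 'b) pre_digraph \<Rightarrow> 'b \<Rightarrow> (('a, 'b) path \<Rightarrow> ('a option, 'b option) path) \<Rightarrow> bool" where
  "subdivision_formulas E g f \<longleftrightarrow>
     (\<forall>v \<in> verts E. f (vertex_path v) = vertex_path (Some v)) \<and>
     (\<forall>e \<in> arcs E. f (arc_path E e) =
        (if e = g
         then path_concat (arc_path (subdivision E g) (Some g)) (arc_path (subdivision E g) None)
         else arc_path (subdivision E g) (Some e)))"

end

theory Submission
  imports Defs
begin

text \<open>
  The homomorphism replaces every occurrence of \<open>g\<close> in an arc list by \<open>gg'\<close>. The image of the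
  arcs leaving \<open>v\<close> is the set of arcs leaving \<open>v\<close> in the subdivision, with \<open>g\<close> extended by
  \<open>g'\<close>, the only arc leaving the new vertex. A path satisfying (iii) at its last arc
  is a prefix of a path in this image; the only proper nonempty prefix of such a path is
  \<open>g\<close>, and it is excluded by the maximality condition (ii).
\<close>

definition subdivide_arcs :: "'b \<Rightarrow> 'b list \<Rightarrow> 'b option list" where
  "subdivide_arcs g es = concat (map (\<lambda>e. if e = g then [Some g, None] else [Some e]) es)"

definition subdivide_path :: "'b \<Rightarrow> ('a, 'b) path \<Rightarrow> ('a option, 'b option) path" where
  "subdivide_path g p = (Some (fst p), subdivide_arcs g (snd p))"

lemma subdivide_arcs_simps [simp]:
  "subdivide_arcs g [] = []"
  "subdivide_arcs g (e # es) =
     (if e = g then Some g # None # subdivide_arcs g es else Some e # subdivide_arcs g es)"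
  "subdivide_arcs g (es @ fs) = subdivide_arcs g es @ subdivide_arcs g fs"
  by (simp_all add: subdivide_arcs_def)

lemma subdivision_simps [simp]:
  "verts (subdivision E g) = insert None (Some ` verts E)"
  "arcs (subdivision E g) = insert None (Some ` arcs E)"
  "tail (subdivision E g) None = None"
  "tail (subdivision E g) (Some e) = Some (tail E e)"
  "head (subdivision E g) None = Some (head E g)"
  "head (subdivision E g) (Some e) = (if e = g then None else Some (head E e))"
  by (simp_all add: subdivision_def)

text \<open>Subdividing redirects only the target of \<open>g\<close>; every old arc keeps its
  source, and the new arc starts at the new vertex.\<close>

lemma out_arcs_subdivision [simp]:
  "out_arcs (subdivision E g) None = {None}"
  "out_arcs (subdivision E g) (Some v) = Some ` out_arcs E v"
  by (auto simp: out_arcs_def)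

text \<open>Arcs other than \<open>g\<close> keep both ends, and gg' runs between the ends of
  \<open>g\<close>, so induction on the walk never gets stuck at the new vertex.\<close>

lemma awalk_subdivide_arcs:
  assumes "wf_digraph E" "g \<in> arcs E" "pre_digraph.awalk E u p v"
  shows "pre_digraph.awalk (subdivision E g) (Some u) (subdivide_arcs g p) (Some v)"
proof -
  interpret E: wf_digraph E by fact
  interpret F: wf_digraph "subdivision E g" by (rule wf_digraph_subdivision[OF assms(1,2)])
  show ?thesis
    using assms(3)
  proof (induction p arbitrary: u)
    case Nil
    then show ?case by (auto simp: E.awalk_Nil_iff F.awalk_Nil_iff)
  next
    case (Cons e p)
    then show ?case using assms(2) by (auto simp: E.awalk_Cons_iff F.awalk_Cons_iff)
  qed
qed

context wf_digraph
begin

lemma path_target_awalk: "awalk u p v \<Longrightarrow> path_target G (u, p) = v"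
  by (simp add: path_target_def)

lemma FP_iff_awalk: "(u, p) \<in> FP G \<longleftrightarrow> awalk u p (path_target G (u, p))"
  using path_target_awalk by (auto simp: FP_def)

lemma vertex_path_in_FP [simp]: "vertex_path v \<in> FP G \<longleftrightarrow> v \<in> verts G"
  by (auto simp: FP_def vertex_path_def awalk_Nil_iff)

lemma arc_path_in_FP [simp]: "e \<in> arcs G \<Longrightarrow> arc_path G e \<in> FP G"
  by (auto simp: FP_def arc_path_def awalk_Cons_iff awalk_Nil_iff)

lemma path_target_simps [simp]:
  "path_target G (u, []) = u"
  "path_target G (u, e # es) = path_target G (head G e, es)"
  by (simp_all add: path_target_def)

end

lemma path_homomorphism_subdivide_path:
  assumes "wf_digraph E" "g \<in> arcs E"
  shows "path_homomorphism E (subdivision E g) (subdivide_path g)"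
proof -
  interpret E: wf_digraph E by fact
  interpret F: wf_digraph "subdivision E g" by (rule wf_digraph_subdivision[OF assms(1,2)])
  \<comment> \<open>Naming the target explicitly lets this one fact give both membership in
    \<open>FP\<close> and compatibility with targets.\<close>
  have walk: "F.awalk (Some u) (subdivide_arcs g p) (Some (path_target E (u, p)))"
    if "(u, p) \<in> FP E" for u p
    using that awalk_subdivide_arcs[OF assms] by (simp add: E.FP_iff_awalk)
  have "subdivide_path g p \<in> FP (subdivision E g)" if "p \<in> FP E" for p
    using walk[of "fst p" "snd p"] that by (auto simp: subdivide_path_def FP_def)
  moreover have "path_target (subdivision E g) (subdivide_path g p) = Some (path_target E p)"
    if "p \<in> FP E" for p
    using F.path_target_awalk[OF walk[of "fst p" "snd p"]] that by (simp add: subdivide_path_def)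
  ultimately show ?thesis
    unfolding path_homomorphism_def
    by (auto simp: subdivide_path_def vertex_path_def path_source_def path_concat_def)
qed

lemma subdivision_formulas_subdivide_path:
  "subdivision_formulas E g (subdivide_path g)"
  by (simp add: subdivision_formulas_def subdivide_path_def vertex_path_def arc_path_def
      path_concat_def)

text \<open>A path of positive length is its first arc followed by a shorter path, so
  multiplicativity propagates agreement by induction. This is what makes the formulas determine the
  homomorphism on \<open>FP E\<close>.\<close>

lemma path_homomorphism_eqI:
  assumes "wf_digraph E" "path_homomorphism E F f" "path_homomorphism E F h"
    and verts: "\<And>v. v \<in> verts E \<Longrightarrow> f (vertex_path v) = h (vertex_path v)"
    and arcs: "\<And>e. e \<in> arcs E \<Longrightarrow> f (arc_path E e) = h (arc_path E e)"
    and "p \<in> FP E"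
  shows "f p = h p"
proof -
  interpret E: wf_digraph E by fact
  have "f (u, es) = h (u, es)" if "E.awalk u es v" for u es v
    using that
  proof (induction es arbitrary: u)
    case Nil
    then show ?case using verts[of u] by (auto simp: E.awalk_Nil_iff vertex_path_def)
  next
    case (Cons e es)
    then have e: "e \<in> arcs E" "u = tail E e" and es: "E.awalk (head E e) es v"
      by (auto simp: E.awalk_Cons_iff)
    \<comment> \<open>Stated for a generic \<open>k\<close> so that it can be used for both
      \<open>f\<close> and \<open>h\<close>.\<close>
    have concat: "k (u, e # es) = path_concat (k (arc_path E e)) (k (head E e, es))"
      if "path_homomorphism E F k" for k
    proof -
      have "(head E e, es) \<in> FP E" using es by (auto simp: FP_def)
      moreover have "path_target E (arc_path E e) = path_source (head E e, es)"
        by (simp add: arc_path_def path_source_def)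
      ultimately have "k (path_concat (arc_path E e) (head E e, es))
          = path_concat (k (arc_path E e)) (k (head E e, es))"
        using that e by (simp add: path_homomorphism_def)
      then show ?thesis using e by (simp add: path_concat_def arc_path_def)
    qed
    show ?case
      using concat[OF assms(2)] concat[OF assms(3)] arcs[OF e(1)] Cons.IH[OF es] by simp
  qed
  then show ?thesis using \<open>p \<in> FP E\<close> by (auto simp: FP_def)
qed

text \<open>The image of an arc \<open>e\<close> begins with \<open>Some e\<close>, so comparing
  first arcs of the two images already gives equality.\<close>

lemma path_monotonic_subdivide_path:
  "path_monotonic E (subdivision E g) (subdivide_path g)"
  by (auto simp: path_monotonic_def path_prefix_def subdivide_path_def arc_path_def
      path_concat_def split: if_splits)

text \<open>This reduces membership in the image to a comparison of lists with one or two
  entries.\<close>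

lemma in_out_image_subdivide_path:
  "(u, es) \<in> out_image E (subdivide_path g) v \<longleftrightarrow>
     u = Some v \<and> (\<exists>e \<in> out_arcs E v. es = (if e = g then [Some g, None] else [Some e]))"
  by (force simp: out_image_def subdivide_path_def arc_path_def)

text \<open>This serves both clauses of \<open>path_regular\<close>; at vertices of
  \<open>regular_verts0\<close> it yields the first alternative.\<close>

lemma regular_at_subdivide_path:
  assumes "wf_digraph E" "g \<in> arcs E"
  shows "regular_at E (subdivision E g) (subdivide_path g) v"
proof -
  interpret E: wf_digraph E by fact
  let ?F = "subdivision E g" and ?f = "subdivide_path g"
  interpret F: wf_digraph ?F by (rule wf_digraph_subdivision[OF assms(1,2)])
  let ?I = "out_image E ?f v"
  have inj: "inj_on ?f (arc_path E ` out_arcs E v)"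
    by (auto simp: inj_on_def subdivide_path_def arc_path_def split: if_splits)
  \<comment> \<open>The completions \<open>r\<close> in condition (iii) are of two kinds: a trivial
    path, or g' after \<open>g\<close>.\<close>
  have head_F: "vertex_path (head ?F e) \<in> FP ?F" if "e \<in> arcs ?F" for e
    using that by (simp only: F.vertex_path_in_FP F.head_in_verts)
  have new_arc: "(None, [None]) \<in> FP ?F"
    using F.arc_path_in_FP[of None] by (simp add: arc_path_def)
  \<comment> \<open>Two image paths with the same first arc come from the same arc of
    \<open>E\<close> and hence coincide, which forces \<open>q\<close> to be trivial.\<close>
  have maximal: "q = vertex_path (path_target ?F (u, es))"
    if "(u, es) \<in> ?I" "path_source q = path_target ?F (u, es)" "path_concat (u, es) q \<in> ?I"
    for u es q
    using that
    by (cases q) (auto simp: in_out_image_subdivide_path path_concat_def path_source_def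
        vertex_path_def split: if_splits)
  have complete: "\<exists>r \<in> FP ?F. path_source r = head ?F e \<and>
      path_concat (u, take i es @ [e]) r \<in> ?I"
    if mem: "(u, es) \<in> ?I" and i: "i < length es" and e: "e \<in> out_arcs ?F (tail ?F (es ! i))"
    for u es i e
  proof -
    obtain a where a: "a \<in> out_arcs E v" "u = Some v"
      "es = (if a = g then [Some g, None] else [Some a])"
      using mem by (auto simp: in_out_image_subdivide_path)
    \<comment> \<open>At position 0 the competing arc \<open>e\<close> is \<open>Some b\<close> for
      some \<open>b\<close> leaving \<open>v\<close>, and \<open>r\<close> completes it to the image
      of \<open>b\<close>.\<close>
    have start: ?thesis if "i = 0"
    proof -
      have "tail ?F (es ! i) = Some v" using a that by auto
      then have "e \<in> Some ` out_arcs E v" using e by (simp only: out_arcs_subdivision)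
      then obtain b where b: "e = Some b" "b \<in> out_arcs E v" by blast
      show ?thesis
      proof (cases "b = g")
        case True
        then show ?thesis
          using b a that
          by (intro bexI[OF _ new_arc])
            (auto simp: in_out_image_subdivide_path path_concat_def path_source_def)
      next
        case False
        then show ?thesis
          using b a that head_F[of e]
          by (intro bexI[of _ "vertex_path (head ?F e)"])
            (auto simp: in_out_image_subdivide_path path_concat_def path_source_def
              vertex_path_def)
      qed
    qed
    show ?thesis
    proof (cases "i = 0")
      case False
      \<comment> \<open>Only the second arc of gg' remains. Its source is the new vertex, so
        \<open>e\<close> is \<open>None\<close> and the path is already gg'.\<close>
      then have "a = g" "i = 1" using i a by (auto split: if_splits)
      then show ?thesis
        using a e head_F[of e]
        by (intro bexI[of _ "vertex_path (head ?F e)"])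
          (auto simp: in_out_image_subdivide_path path_concat_def path_source_def
            vertex_path_def)
    qed (fact start)
  qed
  have converse: "(u, es) \<in> ?I"
    if path: "(u, es) \<in> FP ?F" and "es \<noteq> []"
      and max: "\<And>q. q \<in> FP ?F \<Longrightarrow> path_source q = path_target ?F (u, es) \<Longrightarrow>
        path_concat (u, es) q \<in> ?I \<Longrightarrow> q = vertex_path (path_target ?F (u, es))"
      and compl: "\<And>i e. i < length es \<Longrightarrow> e \<in> out_arcs ?F (tail ?F (es ! i)) \<Longrightarrow>
        \<exists>r \<in> FP ?F. path_source r = head ?F e \<and> path_concat (u, take i es @ [e]) r \<in> ?I"
    for u es
  proof -
    have arcs: "set es \<subseteq> arcs ?F" using path by (auto simp: FP_def F.awalk_def)
    \<comment> \<open>Condition (iii) is applied to the arc \<open>es ! i\<close> itself, so the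
      replaced prefix is again a prefix of \<open>es\<close>; the last index then yields all of
      \<open>es\<close>.\<close>
    have extend: "\<exists>rs. (u, take (Suc i) es @ rs) \<in> ?I" if "i < length es" for i
    proof -
      have "es ! i \<in> out_arcs ?F (tail ?F (es ! i))"
        using subsetD[OF arcs nth_mem[OF that]] by (simp add: out_arcs_def)
      from compl[OF that this] show ?thesis
        using that by (auto simp: path_concat_def take_Suc_conv_app_nth simp del: append_assoc)
    qed
    obtain rs where "(u, es @ rs) \<in> ?I"
      using extend[of "length es - 1"] \<open>es \<noteq> []\<close> by auto
    then obtain a where a: "a \<in> out_arcs E v" "u = Some v"
      "es @ rs = (if a = g then [Some g, None] else [Some a])"
      by (auto simp: in_out_image_subdivide_path)
    show ?thesis
    proof (cases "rs = []")
      case True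
      then show ?thesis using \<open>(u, es @ rs) \<in> ?I\<close> by simp
    next
      case False
      then have "a = g" "es = [Some g]"
        using a(3) \<open>es \<noteq> []\<close> by (auto simp: append_eq_Cons_conv split: if_splits)
      \<comment> \<open>Taking g' for \<open>q\<close> in condition (ii) gives a contradiction,
        since g' is not a trivial path.\<close>
      then have "path_concat (u, es) (None, [None]) \<in> ?I"
        and "path_source (None, [None]) = path_target ?F (u, es)"
        using a by (auto simp: in_out_image_subdivide_path path_concat_def path_source_def)
      with max[OF new_arc] show ?thesis by (simp add: path_source_def vertex_path_def)
    qed
  qed
  have nonempty: "es \<noteq> []" if "(u, es) \<in> ?I" for u es
    using that by (auto simp: in_out_image_subdivide_path split: if_splits)
  show ?thesis
    unfolding regular_at_def
  proof (intro conjI inj ballI, clarify, rule iffI)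
    fix u es
    assume "(u, es) \<in> ?I"
    then show "es \<noteq> [] \<and>
      (\<forall>q \<in> FP ?F. path_source q = path_target ?F (u, es) \<and> path_concat (u, es) q \<in> ?I
        \<longrightarrow> q = vertex_path (path_target ?F (u, es))) \<and>
      (\<forall>i < length es. \<forall>e \<in> out_arcs ?F (tail ?F (es ! i)).
        \<exists>r \<in> FP ?F. path_source r = head ?F e \<and>
          path_concat (u, take i es @ [e]) r \<in> ?I)"
      using nonempty maximal complete by blast
  next
    fix u es
    assume "(u, es) \<in> FP ?F"
    then show "(u, es) \<in> ?I" if "es \<noteq> [] \<and>
      (\<forall>q \<in> FP ?F. path_source q = path_target ?F (u, es) \<and> path_concat (u, es) q \<in> ?I
        \<longrightarrow> q = vertex_path (path_target ?F (u, es))) \<and>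
      (\<forall>i < length es. \<forall>e \<in> out_arcs ?F (tail ?F (es ! i)).
        \<exists>r \<in> FP ?F. path_source r = head ?F e \<and>
          path_concat (u, take i es @ [e]) r \<in> ?I)"
      using that by (intro converse) blast+
  qed
qed

theorem corollary5p22:
  fixes E :: "('a, 'b) pre_digraph" and g :: 'b
  assumes "wf_digraph E"
    and "g \<in> arcs E"
    and "tail E g \<in> regular_verts E"
  shows "\<exists>f. path_homomorphism E (subdivision E g) f \<and> subdivision_formulas E g f \<and>
           (\<forall>h. path_homomorphism E (subdivision E g) h \<and> subdivision_formulas E g h
              \<longrightarrow> (\<forall>p \<in> FP E. h p = f p)) \<and>
           admissible_path_homomorphism E (subdivision E g) f"
proof (intro exI conjI allI impI ballI)
  \<comment> \<open>The argument \<open>g\<close> fixes only the arc type; the constraint fixes the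
    vertex type.\<close>
  let ?f = "subdivide_path g :: ('a, 'b) path \<Rightarrow> _"
  show hom: "path_homomorphism E (subdivision E g) ?f"
    by (rule path_homomorphism_subdivide_path[OF assms(1,2)])
  show formulas: "subdivision_formulas E g ?f"
    by (rule subdivision_formulas_subdivide_path)
  \<comment> \<open>The formulas prescribe the same values for \<open>h\<close> and
    \<open>?f\<close> on vertices and arcs.\<close>
  show "h p = ?f p"
    if "path_homomorphism E (subdivision E g) h \<and> subdivision_formulas E g h" "p \<in> FP E" for h p
    by (rule path_homomorphism_eqI[OF assms(1) _ hom])
      (use that formulas in \<open>auto simp: subdivision_formulas_def\<close>)
  have "inj_on ?f (vertex_path ` verts E)"
    by (auto simp: inj_on_def subdivide_path_def vertex_path_def)
  then show "admissible_path_homomorphism E (subdivision E g) ?f"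
    using hom path_monotonic_subdivide_path regular_at_subdivide_path[OF assms(1,2)]
    by (auto simp: admissible_path_homomorphism_def path_regular_def)
qed

end
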